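(* If $\mathsf{cov}_*(\mathcal{M})=\aleph_1$, then $\theta_*=\aleph_1$.
   Context: Each natural number $k$ is identified with $\{0,\dots,k-1\}$. $\forall^\infty$ means "for all but finitely many". For $f:\mathbb{N}\to\mathbb{N}\setminus\{0\}$, $\mathsf{cov}_f(\mathcal{M})$ is the minimal cardinality of a set $F\subseteq\prod_n f(n)$ such that for every $g\in\mathbb{N}^{\mathbb{N}}$ there is $h\in F$ with $h(n)\neq g(n)$ for all $n$ (functions $f$ for which no such $F$ exists are disregarded in the next minimum). $\mathsf{cov}_*(\mathcal{M})=\min\{\mathsf{cov}_f(\mathcal{M}) : f:\mathbb{N}\to\mathbb{N}\setminus\{0\}\}$. For $f\in\mathbb{N}^{\mathbb{N}}$ with $f(n)\geq 2$ for all $n$, an $f$-sequence is an element $\sigma\in\prod_n P(f(n))$. A family $\mathcal{F}$ of $f$-sequences is $o$-diagonalizable if there is $g\in\mathbb{N}^{\mathbb{N}}$ such that for each $\sigma\in\mathcal{F}$ there is $n$ with $g(n)\in\sigma(n)$. $\theta_f$ is the minimal cardinality of a family $\mathcal{F}$ of $f$-sequences such that: (i) for each $\sigma\in\mathcal{F}$, $(\forall^\infty n)\ \sigma(n)\neq\emptyset$; (ii) for all $\sigma,\eta\in\mathcal{F}$, either $(\forall^\infty n)\ \sigma(n)\subseteq\eta(n)$ or $(\forall^\infty n)\ \eta(n)\subseteq\sigma(n)$; (iii) $\mathcal{F}$ is not $o$-diagonalizable. If there is no such family, $\theta_f=\mathfrak{c}^+$, where $\mathfrak c=2^{\aleph_0}$.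 Finally, $\theta_*=\min\{\theta_f : f\in\mathbb{N}^{\mathbb{N}},\ f(n)\ge 2\text{ for all }n\}$. *)

theory Defs
  imports Main "HOL-Library.FuncSet" "HOL-Library.Nat_Bijection"
begin

unbundle cardinal_syntax

text \<open>
  Cardinals are cardinal orders in the sense of the library, considered up to equipotence
  \<open>=o\<close>.  The minimum of a nonempty set of cardinals is thus determined only up to \<open>=o\<close>, so we
  choose a \<open>\<le>o\<close>-least member; the library lemma \<open>exists_minim_Card_order\<close> guarantees existence.
\<close>

definition least_card :: "'k rel set \<Rightarrow> 'k rel" where
  "least_card K = (SOME \<kappa>. \<kappa> \<in> K \<and> (\<forall>\<kappa>'\<in>K. \<kappa> \<le>o \<kappa>'))"

lemma least_card:
  assumes "K \<noteq> {}" and "\<And>\<kappa>. \<kappa> \<in> K \<Longrightarrow> Card_order \<kappa>"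
  shows "least_card K \<in> K" and "\<kappa> \<in> K \<Longrightarrow> least_card K \<le>o \<kappa>"
proof -
  have "\<exists>\<kappa>. \<kappa> \<in> K \<and> (\<forall>\<kappa>'\<in>K. \<kappa> \<le>o \<kappa>')"
    using exists_minim_Card_order[of K] assms by blast
  from someI_ex[OF this]
  have *: "least_card K \<in> K \<and> (\<forall>\<kappa>'\<in>K. least_card K \<le>o \<kappa>')"
    unfolding least_card_def .
  show "least_card K \<in> K" using * by blast
  show "\<kappa> \<in> K \<Longrightarrow> least_card K \<le>o \<kappa>" using * by blast
qed

abbreviation aleph1 :: "nat set rel" where
  "aleph1 \<equiv> cardSuc natLeq"

abbreviation continuum :: "(nat \<Rightarrow> bool) rel" where
  "continuum \<equiv> ctwo ^c natLeq"


subsection \<open>The cardinal \<open>cov\<^sub>*(M)\<close>\<close>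

definition cov_witness :: "(nat \<Rightarrow> nat) \<Rightarrow> (nat \<Rightarrow> nat) set \<Rightarrow> bool" where
  "cov_witness f F \<longleftrightarrow>
     F \<subseteq> (\<Pi> n\<in>UNIV. {..<f n}) \<and> (\<forall>g. \<exists>h\<in>F. \<forall>n. h n \<noteq> g n)"

definition cov :: "(nat \<Rightarrow> nat) \<Rightarrow> (nat \<Rightarrow> nat) rel" where
  "cov f = least_card {|F| | F. cov_witness f F}"

definition cov_star :: "(nat \<Rightarrow> nat) rel" where
  "cov_star = least_card {cov f | f. (\<forall>n. f n \<noteq> 0) \<and> (\<exists>F. cov_witness f F)}"


subsection \<open>The cardinal \<open>\<theta>\<^sub>*\<close>\<close>

definition f_sequences :: "(nat \<Rightarrow> nat) \<Rightarrow> (nat \<Rightarrow> nat set) set" where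
  "f_sequences f = (\<Pi> n\<in>UNIV. Pow {..<f n})"

definition o_diagonalizable :: "(nat \<Rightarrow> nat set) set \<Rightarrow> bool" where
  "o_diagonalizable F \<longleftrightarrow> (\<exists>g :: nat \<Rightarrow> nat. \<forall>\<sigma>\<in>F. \<exists>n. g n \<in> \<sigma> n)"

definition theta_witness :: "(nat \<Rightarrow> nat) \<Rightarrow> (nat \<Rightarrow> nat set) set \<Rightarrow> bool" where
  "theta_witness f F \<longleftrightarrow>
     F \<subseteq> f_sequences f \<and>
     (\<forall>\<sigma>\<in>F. \<forall>\<^sub>\<infinity>n. \<sigma> n \<noteq> {}) \<and>
     (\<forall>\<sigma>\<in>F. \<forall>\<eta>\<in>F. (\<forall>\<^sub>\<infinity>n. \<sigma> n \<subseteq> \<eta> n) \<or> (\<forall>\<^sub>\<infinity>n. \<eta> n \<subseteq> \<sigma> n)) \<and>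
     \<not> o_diagonalizable F"

text \<open>
  The cardinality of a family and the default value, the successor of the continuum, have to live
  on one type.  We use the type of \<open>cardSuc continuum\<close>; it is large enough to carry a copy of
  \<open>|F|\<close> for every family \<open>F\<close>, see \<open>theta_copy\<close> below.
\<close>

definition theta :: "(nat \<Rightarrow> nat) \<Rightarrow> (nat \<Rightarrow> bool) set rel" where
  "theta f =
     (if \<exists>F. theta_witness f F
      then least_card {\<kappa>. Card_order \<kappa> \<and> (\<exists>F. theta_witness f F \<and> \<kappa> =o |F| )}
      else cardSuc continuum)"

definition theta_star :: "(nat \<Rightarrow> bool) set rel" where
  "theta_star = least_card {theta f | f. \<forall>n. f n \<ge> 2}"


subsection \<open>The minima are attained\<close>

lemma cov_attained:
  assumes "cov_witness f F"
  shows "\<exists>F. cov_witness f F \<and> cov f = |F|" and "cov f \<le>o |F|"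
proof -
  let ?K = "{|F| | F. cov_witness f F}"
  have ne: "?K \<noteq> {}" and c: "\<And>\<kappa>. \<kappa> \<in> ?K \<Longrightarrow> Card_order \<kappa>"
    using assms by (auto intro: card_of_Card_order)
  show "\<exists>F. cov_witness f F \<and> cov f = |F|"
    using least_card(1)[OF ne c] unfolding cov_def by blast
  have "|F| \<in> ?K" using assms by blast
  then show "cov f \<le>o |F|"
    using least_card(2)[OF ne c] unfolding cov_def by blast
qed

lemma cov_witness_2: "cov_witness (\<lambda>_. 2) (\<Pi> n\<in>UNIV. {..<2})"
proof -
  have "\<exists>h\<in>(\<Pi> n\<in>UNIV. {..<2}). \<forall>n. h n \<noteq> g n" for g :: "nat \<Rightarrow> nat"
    by (rule bexI[where x = "\<lambda>n. if g n = 0 then 1 else 0"]) auto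
  then show ?thesis by (simp add: cov_witness_def)
qed

lemma cov_star_attained:
  shows "\<exists>f. (\<forall>n. f n \<noteq> 0) \<and> (\<exists>F. cov_witness f F) \<and> cov_star = cov f"
    and "\<lbrakk>\<forall>n. f n \<noteq> 0; cov_witness f F\<rbrakk> \<Longrightarrow> cov_star \<le>o cov f"
proof -
  let ?K = "{cov f | f. (\<forall>n. f n \<noteq> 0) \<and> (\<exists>F. cov_witness f F)}"
  have "cov (\<lambda>_. 2) \<in> ?K" using cov_witness_2 by (intro CollectI exI[of _ "\<lambda>_. 2"]) auto
  then have ne: "?K \<noteq> {}" by blast
  have c: "Card_order \<kappa>" if "\<kappa> \<in> ?K" for \<kappa>
    using that cov_attained(1) card_of_Card_order by fastforce
  show "\<exists>f. (\<forall>n. f n \<noteq> 0) \<and> (\<exists>F. cov_witness f F) \<and> cov_star = cov f"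
    using least_card(1)[OF ne c] unfolding cov_star_def by blast
  assume "\<forall>n. f n \<noteq> 0" "cov_witness f F"
  then have "cov f \<in> ?K" by blast
  then show "cov_star \<le>o cov f"
    using least_card(2)[OF ne c] unfolding cov_star_def by blast
qed

lemma theta_copy:
  fixes F :: "(nat \<Rightarrow> nat set) set"
  shows "\<exists>\<kappa> :: (nat \<Rightarrow> bool) set rel. Card_order \<kappa> \<and> \<kappa> =o |F|"
proof -
  define enc :: "(nat \<Rightarrow> nat set) \<Rightarrow> (nat \<Rightarrow> bool) set"
    where "enc \<sigma> = {\<lambda>k. snd (prod_decode k) \<in> \<sigma> (fst (prod_decode k))}" for \<sigma>
  have "inj enc"
  proof (rule injI, intro ext set_eqI)
    fix \<sigma> \<tau> n m
    assume "enc \<sigma> = enc \<tau>"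
    then have "(\<lambda>k. snd (prod_decode k) \<in> \<sigma> (fst (prod_decode k)))
        = (\<lambda>k. snd (prod_decode k) \<in> \<tau> (fst (prod_decode k)))"
      by (simp only: enc_def singleton_inject)
    from fun_cong[OF this, of "prod_encode (n, m)"]
    show "m \<in> \<sigma> n \<longleftrightarrow> m \<in> \<tau> n" by simp
  qed
  then have "inj_on enc F" by (rule inj_on_subset) simp
  then have "|F| =o |enc ` F|"
    using card_of_ordIsoI[of enc F "enc ` F"] by (simp add: bij_betw_def)
  then have "|enc ` F| =o |F|" by (rule ordIso_symmetric)
  then show ?thesis using card_of_Card_order by blast
qed

lemma theta_attained:
  assumes "theta_witness f F"
  shows "\<exists>F. theta_witness f F \<and> theta f =o |F|" and "theta f \<le>o |F|"
    and "Card_order (theta f)"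
proof -
  let ?K = "{\<kappa> :: (nat \<Rightarrow> bool) set rel. Card_order \<kappa> \<and> (\<exists>F. theta_witness f F \<and> \<kappa> =o |F| )}"
  obtain \<kappa> :: "(nat \<Rightarrow> bool) set rel" where \<kappa>: "Card_order \<kappa>" "\<kappa> =o |F|"
    using theta_copy by blast
  have mem: "\<kappa> \<in> ?K" using \<kappa> assms by blast
  then have ne: "?K \<noteq> {}" by blast
  have t: "theta f = least_card ?K" using assms by (auto simp: theta_def)
  have "theta f \<in> ?K" unfolding t by (rule least_card(1)[OF ne]) blast
  then show "\<exists>F. theta_witness f F \<and> theta f =o |F|" and "Card_order (theta f)"
    by blast+
  have "theta f \<le>o \<kappa>" unfolding t by (rule least_card(2)[OF ne _ mem]) blast
  then show "theta f \<le>o |F|" using \<kappa>(2) by (rule ordLeq_ordIso_trans)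
qed

lemma Card_order_theta: "Card_order (theta f)"
proof (cases "\<exists>F. theta_witness f F")
  case True
  then show ?thesis using theta_attained(3) by blast
next
  case False
  then show ?thesis by (simp add: theta_def cardSuc_Card_order Card_order_cexp)
qed

lemma theta_star_attained:
  shows "\<exists>f. (\<forall>n. f n \<ge> 2) \<and> theta_star = theta f"
    and "\<forall>n. f n \<ge> 2 \<Longrightarrow> theta_star \<le>o theta f"
proof -
  let ?K = "{theta f | f. \<forall>n. f n \<ge> 2}"
  have "theta (\<lambda>_. 2) \<in> ?K" by force
  then have ne: "?K \<noteq> {}" by blast
  have c: "Card_order \<kappa>" if "\<kappa> \<in> ?K" for \<kappa>
    using that Card_order_theta by blast
  show "\<exists>f. (\<forall>n. f n \<ge> 2) \<and> theta_star = theta f"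
    using least_card(1)[OF ne c] unfolding theta_star_def by blast
  assume "\<forall>n. f n \<ge> 2"
  then have "theta f \<in> ?K" by blast
  then show "theta_star \<le>o theta f"
    using least_card(2)[OF ne c] unfolding theta_star_def by blast
qed

end

theory Submission
  imports Defs "HOL-Library.Countable_Set"
begin

text \<open>
  Let \<open>H\<close> be a family of size \<open>\<aleph>\<^sub>1\<close> witnessing \<open>cov f = \<aleph>\<^sub>1\<close>.  Split the coordinates of \<open>f\<close> into
  blocks, the \<open>n\<close>-th block having \<open>n\<close> coordinates, and well-order \<open>H\<close> in type \<open>\<omega>\<^sub>1\<close>.
  By recursion on \<open>h \<in> H\<close> choose partial functions \<open>p h n\<close> on the \<open>n\<close>-th block,
  increasing modulo finite in \<open>h\<close>, with more and more undefined coordinates as \<open>n\<close> grows,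
  and such that \<open>p h n\<close> agrees with \<open>h\<close> at some coordinate of block \<open>n\<close>; as initial segments are
  countable, a diagonal union gets past every limit.  The sets of (codes of) total extensions of
  \<open>p h n\<close> form a chain modulo finite.  A function \<open>g\<close> guessing elements of these sets is a function
  on all coordinates; an \<open>h\<close> differing from it everywhere shows that \<open>g\<close> never guesses an
  extension of \<open>p h n\<close>.  Conversely, a countable family is diagonalized by handling its members at
  distinct arguments.
\<close>

section \<open>Diagonal bounds modulo finite\<close>

text \<open>Let \<open>m n\<close> be the largest \<open>k \<le> n\<close> such that
  \<open>P i n\<close> for all \<open>i \<le> k\<close>. Any finitely many \<open>P i\<close> hold
  together almost everywhere, so \<open>m\<close> tends to infinity.\<close>

lemma MOST_diagonal:
  fixes P :: "nat \<Rightarrow> nat \<Rightarrow> bool"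
  assumes "\<And>k. \<forall>\<^sub>\<infinity>n. P k n"
  obtains m where "\<forall>\<^sub>\<infinity>n. P (m n) n" and "\<And>k. \<forall>\<^sub>\<infinity>n. k \<le> m n"
proof -
  \<comment> \<open>The inserted 0 keeps \<open>S n\<close> nonempty; hence \<open>P (m n) n\<close>
    is sure only where \<open>P 0 n\<close> holds.\<close>
  define S where "S n = insert 0 {k. k \<le> n \<and> (\<forall>i\<le>k. P i n)}" for n
  define m where "m n = Max (S n)" for n
  have fin: "finite (S n)" for n by (simp add: S_def)
  have mem: "m n \<in> S n" for n
    unfolding m_def by (rule Max_in[OF fin]) (simp add: S_def)
  have P: "P (m n) n" if "P 0 n" for n
    using mem[of n] that by (auto simp: S_def)
  have large: "\<forall>\<^sub>\<infinity>n. k \<le> m n" for k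
  proof -
    have "\<forall>\<^sub>\<infinity>n. \<forall>i\<in>{..k}. P i n"
      using assms by (subst eventually_ball_finite_distrib) auto
    moreover have "\<forall>\<^sub>\<infinity>n. k \<le> n" by (simp add: MOST_ge_nat)
    ultimately show ?thesis
    proof eventually_elim
      case (elim n)
      then have "k \<in> S n" by (auto simp: S_def)
      then show ?case unfolding m_def by (rule Max_ge[OF fin])
    qed
  qed
  have "\<forall>\<^sub>\<infinity>n. P (m n) n" using assms[of 0] by eventually_elim (rule P)
  then show thesis using large by (rule that)
qed

lemma finite_chain_Union_mem:
  assumes "finite A" "A \<noteq> {}" "\<forall>i\<in>A. \<forall>j\<in>A. c i \<subseteq> c j \<or> c j \<subseteq> c i"
  shows "\<exists>i\<in>A. (\<Union>i\<in>A. c i) = c i"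
  using assms
proof (induction rule: finite_ne_induct)
  case (singleton x)
  then show ?case by simp
next
  case (insert x A)
  then obtain i where i: "i \<in> A" "(\<Union>i\<in>A. c i) = c i" by blast
  then have "c x \<subseteq> c i \<or> c i \<subseteq> c x" using insert.prems by blast
  then show ?case using i by auto
qed

text \<open>For finite sets: the number of free places in block \<open>n\<close> tends to infinity.
  This survives adding one pair per block.\<close>

definition slack :: "(nat \<Rightarrow> 'a set) \<Rightarrow> bool" where
  "slack p \<longleftrightarrow> (\<forall>k. \<forall>\<^sub>\<infinity>n. card (p n) + k \<le> n)"

text \<open>At \<open>n\<close> only members of index up to \<open>m n\<close> are united, with
  \<open>m\<close> growing so slowly that they form a chain under inclusion there and leave
  \<open>m n\<close> places free. The union is then one of them, so \<open>q\<close> is slack and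
  inherits properties of the sets \<open>c i n\<close>.\<close>

lemma countable_chain_bound:
  fixes c :: "nat \<Rightarrow> nat \<Rightarrow> 'a set"
  assumes slack: "\<And>i. slack (c i)"
    and chain: "\<And>i j. (\<forall>\<^sub>\<infinity>n. c i n \<subseteq> c j n) \<or> (\<forall>\<^sub>\<infinity>n. c j n \<subseteq> c i n)"
  obtains q where "slack q" and "\<And>i. \<forall>\<^sub>\<infinity>n. c i n \<subseteq> q n"
    and "\<And>n. q n = {} \<or> (\<exists>i. q n = c i n)"
proof -
  define P where "P k n \<longleftrightarrow>
      (\<forall>i\<in>{..k}. \<forall>j\<in>{..k}. c i n \<subseteq> c j n \<or> c j n \<subseteq> c i n) \<and>
      (\<forall>i\<in>{..k}. card (c i n) + k \<le> n)" for k n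
  have "\<forall>\<^sub>\<infinity>n. P k n" for k
  proof -
    have "\<forall>\<^sub>\<infinity>n. c i n \<subseteq> c j n \<or> c j n \<subseteq> c i n" for i j
      using chain[of i j] by (auto elim: eventually_mono)
    then show ?thesis
      using slack unfolding P_def slack_def
      by (intro eventually_conj) (simp_all add: eventually_ball_finite_distrib)
  qed
  then obtain m where m: "\<forall>\<^sub>\<infinity>n. P (m n) n" "\<And>k. \<forall>\<^sub>\<infinity>n. k \<le> m n"
    using MOST_diagonal by metis
  define q where "q n = (if P (m n) n then \<Union>i\<in>{..m n}. c i n else {})" for n
  have q: "\<exists>i\<in>{..m n}. q n = c i n" if "P (m n) n" for n
    using finite_chain_Union_mem[of "{..m n}" "\<lambda>i. c i n"] that by (simp add: q_def P_def)
  show thesis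
  proof
    show "slack q" unfolding slack_def
    proof
      fix k
      from m(1) m(2)[of k] show "\<forall>\<^sub>\<infinity>n. card (q n) + k \<le> n"
      proof eventually_elim
        case (elim n)
        then obtain i where "i \<in> {..m n}" "q n = c i n" using q by blast
        then have "card (q n) + m n \<le> n" using elim(1) by (simp add: P_def)
        then show ?case using elim(2) by simp
      qed
    qed
    show "\<forall>\<^sub>\<infinity>n. c i n \<subseteq> q n" for i
      using m(1) m(2)[of i] by eventually_elim (auto simp: q_def)
    show "q n = {} \<or> (\<exists>i. q n = c i n)" for n
      using q[of n] by (auto simp: q_def)
  qed
qed

section \<open>Partial functions on blocks and codes of their extensions\<close>

text \<open>The \<open>j\<close>-th coordinate of block \<open>n\<close>, for \<open>j < n\<close>, is \<open>prod_encode (n, j)\<close>.\<close>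

definition section_on_block :: "(nat \<Rightarrow> nat) \<Rightarrow> nat \<Rightarrow> (nat \<times> nat) set \<Rightarrow> bool" where
  "section_on_block f n p \<longleftrightarrow>
     single_valued p \<and> p \<subseteq> (SIGMA j:{..<n}. {..<f (prod_encode (n, j))})"

definition extensions :: "(nat \<Rightarrow> nat) \<Rightarrow> nat \<Rightarrow> (nat \<times> nat) set \<Rightarrow> nat set" where
  "extensions f n p = list_encode `
     {xs. length xs = n \<and> (\<forall>j<n. xs ! j < f (prod_encode (n, j))) \<and> (\<forall>(j, v)\<in>p. xs ! j = v)}"

text \<open>One \<open>Suc\<close> makes the bound strict, the other makes it at least 2, as
  \<open>theta_star\<close> demands; the inserted 0 keeps \<open>Max\<close> defined when there are
  no extensions.\<close>

definition block_bound :: "(nat \<Rightarrow> nat) \<Rightarrow> nat \<Rightarrow> nat" where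
  "block_bound f n = Suc (Suc (Max (insert 0 (extensions f n {}))))"

lemma extensions_mono: "p \<subseteq> q \<Longrightarrow> extensions f n q \<subseteq> extensions f n p"
  unfolding extensions_def by (rule image_mono, rule Collect_mono) (auto dest: subsetD)

lemma finite_extensions: "finite (extensions f n p)"
proof -
  let ?b = "Max ((\<lambda>j. f (prod_encode (n, j))) ` {..<n})"
  have "f (prod_encode (n, j)) \<le> ?b" if "j < n" for j
    using that by (intro Max_ge) auto
  then have "{xs. length xs = n \<and> (\<forall>j<n. xs ! j < f (prod_encode (n, j))) \<and> (\<forall>(j, v)\<in>p. xs ! j = v)}
      \<subseteq> {xs. set xs \<subseteq> {..<?b} \<and> length xs = n}"
    by (fastforce simp: in_set_conv_nth intro: less_le_trans)
  then show ?thesis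
    unfolding extensions_def
    by (intro finite_imageI) (rule finite_subset, auto intro: finite_lists_length_eq)
qed

lemma extensions_bounded: "extensions f n p \<subseteq> {..<block_bound f n}"
proof
  fix x assume "x \<in> extensions f n p"
  then have "x \<in> extensions f n {}" using extensions_mono[of "{}" p] by blast
  then have "x \<le> Max (insert 0 (extensions f n {}))"
    by (intro Max_ge) (auto simp: finite_extensions)
  then show "x \<in> {..<block_bound f n}" by (simp add: block_bound_def)
qed

lemma extensions_nonempty:
  assumes f: "\<And>k. f k \<noteq> 0" and p: "section_on_block f n p"
  shows "extensions f n p \<noteq> {}"
proof -
  \<comment> \<open>Undefined coordinates get 0, an admissible value because \<open>f\<close> has no
    zeros.\<close>
  define v where "v j = (if j \<in> Domain p then THE v. (j, v) \<in> p else 0)" for j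
  have v: "v j = w" if "(j, w) \<in> p" for j w
    using that p unfolding v_def section_on_block_def single_valued_def by auto
  have "v j < f (prod_encode (n, j))" for j
  proof (cases "j \<in> Domain p")
    case True
    then obtain w where "(j, w) \<in> p" by blast
    then show ?thesis using v p by (auto simp: section_on_block_def)
  next
    case False
    then show ?thesis using f by (simp add: v_def)
  qed
  moreover have "map v [0..<n] ! j = w" if "(j, w) \<in> p" for j w
    using that v p by (auto simp: section_on_block_def)
  ultimately have "list_encode (map v [0..<n]) \<in> extensions f n p"
    unfolding extensions_def by (intro imageI CollectI) auto
  then show ?thesis by blast
qed

lemma section_on_block_free_coordinate:
  assumes "section_on_block f n p" "card p < n"
  shows "\<exists>j<n. j \<notin> Domain p"
proof -
  have "finite p"
    using assms(1) unfolding section_on_block_def by (auto intro: finite_subset)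
  then have "card (Domain p) \<le> card p" by (simp add: Domain_fst card_image_le)
  then have "\<not> {..<n} \<subseteq> Domain p"
    using assms(2) \<open>finite p\<close> card_mono[of "Domain p" "{..<n}"] by (auto simp: finite_Domain)
  then show ?thesis by blast
qed

section \<open>The tower of partial functions\<close>

text \<open>Once the countable chain has a slack bound \<open>r\<close>, almost every block still
  has a free coordinate; one is spent on recording the value of \<open>h\<close> there.\<close>

lemma tower_step:
  assumes C: "countable C" and slack: "\<And>p. p \<in> C \<Longrightarrow> slack p"
    and sec: "\<And>p n. p \<in> C \<Longrightarrow> section_on_block f n (p n)"
    and chain: "\<And>p q. p \<in> C \<Longrightarrow> q \<in> C \<Longrightarrow> (\<forall>\<^sub>\<infinity>n. p n \<subseteq> q n) \<or> (\<forall>\<^sub>\<infinity>n. q n \<subseteq> p n)"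
    and h: "\<And>k. h k < f k"
  shows "\<exists>q. slack q \<and> (\<forall>n. section_on_block f n (q n)) \<and> (\<forall>p\<in>C. \<forall>\<^sub>\<infinity>n. p n \<subseteq> q n) \<and>
    (\<forall>\<^sub>\<infinity>n. \<exists>j<n. (j, h (prod_encode (n, j))) \<in> q n)"
proof -
  \<comment> \<open>The everywhere empty function lies below all others and makes the family
    nonempty, as an enumeration by \<open>nat\<close> requires.\<close>
  define C' where "C' = insert (\<lambda>n. {}) C"
  define c where "c = from_nat_into C'"
  have c: "range c = C'"
    unfolding c_def using C by (intro range_from_nat_into) (simp_all add: C'_def)
  have c': "c i \<in> C'" for i using c by blast
  have sl: "slack p" if "p \<in> C'" for p
    using that slack by (auto simp: C'_def slack_def MOST_ge_nat)
  have sec': "section_on_block f n (p n)" if "p \<in> C'" for p n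
    using that sec by (auto simp: C'_def section_on_block_def)
  have ch: "(\<forall>\<^sub>\<infinity>n. p n \<subseteq> q n) \<or> (\<forall>\<^sub>\<infinity>n. q n \<subseteq> p n)" if "p \<in> C'" "q \<in> C'" for p q
    using that chain by (auto simp: C'_def)
  obtain r where r: "slack r" "\<And>i. \<forall>\<^sub>\<infinity>n. c i n \<subseteq> r n" "\<And>n. r n = {} \<or> (\<exists>i. r n = c i n)"
    by (rule countable_chain_bound[of c, OF sl ch]) (rule c', rule c', rule c', rule that)
  have rsec: "section_on_block f n (r n)" for n
    using r(3)[of n] sec'[OF c'] by (auto simp: section_on_block_def)
  have "\<exists>j. card (r n) < n \<longrightarrow> j < n \<and> j \<notin> Domain (r n)" for n
    using section_on_block_free_coordinate[OF rsec] by blast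
  then obtain j where j: "\<And>n. card (r n) < n \<Longrightarrow> j n < n \<and> j n \<notin> Domain (r n)"
    by metis
  \<comment> \<open>In the finitely many blocks without room, \<open>r n\<close> stays as it
    is.\<close>
  define q where
    "q n = (if card (r n) < n then insert (j n, h (prod_encode (n, j n))) (r n) else r n)" for n
  have "slack q" unfolding slack_def
  proof
    fix k
    have "\<forall>\<^sub>\<infinity>n. card (r n) + Suc k \<le> n" using r(1) by (simp only: slack_def)
    then show "\<forall>\<^sub>\<infinity>n. card (q n) + k \<le> n"
    proof eventually_elim
      case (elim n)
      have "card (q n) \<le> Suc (card (r n))" by (auto simp: q_def intro: card_insert_le_m1)
      then show ?case using elim by simp
    qed
  qed
  moreover have "section_on_block f n (q n)" for n
    using rsec[of n] j[of n] h unfolding q_def section_on_block_def single_valued_def by auto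
  moreover have "\<forall>\<^sub>\<infinity>n. p n \<subseteq> q n" if "p \<in> C" for p
  proof -
    have "p \<in> range c" using that c by (simp add: C'_def)
    then obtain i where "p = c i" by blast
    then show ?thesis using r(2)[of i] by (auto simp: q_def elim: eventually_mono)
  qed
  moreover have "\<forall>\<^sub>\<infinity>n. \<exists>j<n. (j, h (prod_encode (n, j))) \<in> q n"
  proof -
    have "\<forall>\<^sub>\<infinity>n. card (r n) + 1 \<le> n" using r(1) unfolding slack_def by blast
    then show ?thesis
    proof eventually_elim
      case (elim n)
      then have "card (r n) < n" by simp
      then have "j n < n \<and> (j n, h (prod_encode (n, j n))) \<in> q n"
        using j[of n] by (simp add: q_def)
      then show ?case by blast
    qed
  qed
  ultimately show ?thesis by blast
qed

lemma countable_underS: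
  assumes "r \<le>o aleph1" "Card_order r"
  shows "countable (underS r a)"
proof (cases "a \<in> Field r")
  case True
  then have "|underS r a| <o aleph1"
    using card_of_underS[OF assms(2)] assms(1) ordLess_ordLeq_trans by blast
  then have "|underS r a| \<le>o natLeq"
    using cardSuc_ordLeq_ordLess[OF natLeq_Card_order card_of_Card_order] by blast
  then show ?thesis
    by (metis card_of_nat card_of_ordLeq countable_def ordIso_symmetric ordLeq_ordIso_trans)
next
  case False
  then have "underS r a = {}" by (auto simp: underS_def Field_def)
  then show ?thesis by simp
qed

lemma tower_exists:
  assumes card: "|H| \<le>o aleph1" and H: "\<And>h k. h \<in> H \<Longrightarrow> h k < f k"
  obtains p :: "(nat \<Rightarrow> nat) \<Rightarrow> nat \<Rightarrow> (nat \<times> nat) set"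
  where "\<And>h n. h \<in> H \<Longrightarrow> section_on_block f n (p h n)"
    and "\<And>h h'. h \<in> H \<Longrightarrow> h' \<in> H \<Longrightarrow>
      (\<forall>\<^sub>\<infinity>n. p h n \<subseteq> p h' n) \<or> (\<forall>\<^sub>\<infinity>n. p h' n \<subseteq> p h n)"
    and "\<And>h. h \<in> H \<Longrightarrow> \<forall>\<^sub>\<infinity>n. \<exists>j<n. (j, h (prod_encode (n, j))) \<in> p h n"
proof -
  interpret wo_rel "|H|"
    using card_of_Well_order by (simp add: wo_rel_def)
  let ?R = "|H| - Id"
  \<comment> \<open>The recursion ranges over the whole type, hence the guard
    \<open>h \<in> H\<close>. Being a chain is not demanded: it follows from the bounds by totality
    of the order.\<close>
  define P where "P p h q \<longleftrightarrow> (h \<in> H \<longrightarrow> slack q \<and> (\<forall>n. section_on_block f n (q n)) \<and>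
      (\<forall>h'. (h', h) \<in> ?R \<longrightarrow> (\<forall>\<^sub>\<infinity>n. p h' n \<subseteq> q n)) \<and>
      (\<forall>\<^sub>\<infinity>n. \<exists>j<n. (j, h (prod_encode (n, j))) \<in> q n))"
    for p :: "(nat \<Rightarrow> nat) \<Rightarrow> nat \<Rightarrow> (nat \<times> nat) set" and h q
  have inH: "h \<in> H" "h' \<in> H" if "(h, h') \<in> ?R" for h h'
    using that by (auto simp: Field_card_of dest: FieldI1 FieldI2)
  have tot: "h = h' \<or> (h, h') \<in> ?R \<or> (h', h) \<in> ?R" if "h \<in> H" "h' \<in> H" for h h'
    using that TOTAL by (auto simp: total_on_def Field_card_of)
  have comparable: "(\<forall>\<^sub>\<infinity>n. p h n \<subseteq> p h' n) \<or> (\<forall>\<^sub>\<infinity>n. p h' n \<subseteq> p h n)"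
    if "h \<in> H" "h' \<in> H" "P p h (p h)" "P p h' (p h')" for p h h'
    using tot[OF that(1,2)] that by (auto simp: P_def)
  have "\<exists>p. \<forall>h. P p h (p h)"
  proof (rule dependent_wf_choice)
    show "wf ?R" by (rule WF)
    show "P p h q = P p' h q" if "\<And>z. (z, h) \<in> ?R \<Longrightarrow> p z = p' z" for p p' h q
      using that by (auto simp: P_def)
    show "\<exists>q. P p h q" if IH: "\<And>h'. (h', h) \<in> ?R \<Longrightarrow> P p h' (p h')" for h p
    proof (cases "h \<in> H")
      case True
      have "{h'. (h', h) \<in> ?R} = Order_Relation.underS ( |H| ) h"
        by (auto simp: Order_Relation.underS_def)
      then have "countable (p ` {h'. (h', h) \<in> ?R})"
        using countable_underS[OF card card_of_Card_order] by simp
      then have "\<exists>q. slack q \<and> (\<forall>n. section_on_block f n (q n)) \<and>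
          (\<forall>p\<in>p ` {h'. (h', h) \<in> ?R}. \<forall>\<^sub>\<infinity>n. p n \<subseteq> q n) \<and>
          (\<forall>\<^sub>\<infinity>n. \<exists>j<n. (j, h (prod_encode (n, j))) \<in> q n)"
      proof (rule tower_step)
        fix s assume "s \<in> p ` {h'. (h', h) \<in> ?R}"
        then obtain h' where h': "(h', h) \<in> ?R" "s = p h'" by blast
        then have s: "slack s \<and> (\<forall>n. section_on_block f n (s n))"
          using IH[OF h'(1)] inH(1)[OF h'(1)] by (simp add: P_def)
        show "slack s" and "section_on_block f n (s n)" for n using s by simp_all
        fix t assume "t \<in> p ` {h'. (h', h) \<in> ?R}"
        then obtain h'' where h'': "(h'', h) \<in> ?R" "t = p h''" by blast
        show "(\<forall>\<^sub>\<infinity>n. s n \<subseteq> t n) \<or> (\<forall>\<^sub>\<infinity>n. t n \<subseteq> s n)"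
          unfolding h'(2) h''(2)
          by (rule comparable[OF inH(1)[OF h'(1)] inH(1)[OF h''(1)] IH[OF h'(1)] IH[OF h''(1)]])
      qed (rule H[OF True])
      then show ?thesis unfolding P_def by blast
    qed (simp add: P_def)
  qed
  then obtain p where p: "\<And>h. P p h (p h)" by blast
  show thesis
  proof (rule that[of p])
    show "section_on_block f n (p h n)" if "h \<in> H" for h n
      using p[of h] that by (simp add: P_def)
    show "(\<forall>\<^sub>\<infinity>n. p h n \<subseteq> p h' n) \<or> (\<forall>\<^sub>\<infinity>n. p h' n \<subseteq> p h n)" if "h \<in> H" "h' \<in> H" for h h'
      using comparable[OF that p p] .
    show "\<forall>\<^sub>\<infinity>n. \<exists>j<n. (j, h (prod_encode (n, j))) \<in> p h n" if "h \<in> H" for h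
      using p[of h] that by (simp add: P_def)
  qed
qed

section \<open>From the tower to a family of set sequences\<close>

text \<open>Larger partial functions have fewer extensions, so the tower yields a chain under
  reversed inclusion. A diagonalizing \<open>g\<close>, decoded to a function on all coordinates,
  would agree somewhere with every \<open>h \<in> H\<close>.\<close>

lemma theta_witness_from_cov_witness:
  assumes f: "\<And>k. f k \<noteq> 0" and H: "cov_witness f H" and card: "|H| \<le>o aleph1"
  obtains F where "theta_witness (block_bound f) F" "|F| \<le>o |H|"
proof -
  have Hf: "h k < f k" if "h \<in> H" for h k
    using H that by (auto simp: cov_witness_def)
  obtain p where sec: "\<And>h n. h \<in> H \<Longrightarrow> section_on_block f n (p h n)"
    and chain: "\<And>h h'. h \<in> H \<Longrightarrow> h' \<in> H \<Longrightarrow>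
      (\<forall>\<^sub>\<infinity>n. p h n \<subseteq> p h' n) \<or> (\<forall>\<^sub>\<infinity>n. p h' n \<subseteq> p h n)"
    and hit: "\<And>h. h \<in> H \<Longrightarrow> \<forall>\<^sub>\<infinity>n. \<exists>j<n. (j, h (prod_encode (n, j))) \<in> p h n"
    by (rule tower_exists[OF card, of f]) (erule Hf, rule that)
  define hits where "hits h n \<longleftrightarrow> (\<exists>j<n. (j, h (prod_encode (n, j))) \<in> p h n)" for h n
  \<comment> \<open>A single \<open>n\<close> with \<open>g n \<in> \<sigma> h n\<close> already
    counts as success, so blocks where \<open>p h n\<close> does not meet \<open>h\<close> are
    emptied. They are finitely many, which the conditions modulo finite tolerate.\<close>
  define \<sigma> where "\<sigma> h n = (if hits h n then extensions f n (p h n) else {})" for h n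
  have hits: "\<forall>\<^sub>\<infinity>n. hits h n" if "h \<in> H" for h
    using hit[OF that] by (simp add: hits_def)
  have ordered: "\<forall>\<^sub>\<infinity>n. \<sigma> h' n \<subseteq> \<sigma> h n"
    if "h \<in> H" "\<forall>\<^sub>\<infinity>n. p h n \<subseteq> p h' n" for h h'
    using that(2) hits[OF that(1)] by eventually_elim (simp add: \<sigma>_def extensions_mono)
  have diag: "\<not> o_diagonalizable (\<sigma> ` H)"
  proof
    assume "o_diagonalizable (\<sigma> ` H)"
    then obtain g where g: "\<And>h. h \<in> H \<Longrightarrow> \<exists>n. g n \<in> \<sigma> h n"
      by (auto simp: o_diagonalizable_def)
    define g' where "g' k = list_decode (g (fst (prod_decode k))) ! snd (prod_decode k)" for k
    obtain h where h: "h \<in> H" "\<And>k. h k \<noteq> g' k"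
      using H unfolding cov_witness_def by metis
    obtain n where n: "g n \<in> \<sigma> h n" using g[OF h(1)] by blast
    then have "hits h n" by (auto simp: \<sigma>_def split: if_splits)
    then obtain j where j: "(j, h (prod_encode (n, j))) \<in> p h n" by (auto simp: hits_def)
    have "g n \<in> extensions f n (p h n)" using n by (simp add: \<sigma>_def split: if_splits)
    then have "list_decode (g n) ! j = h (prod_encode (n, j))"
      using j by (auto simp: extensions_def)
    then show False using h(2)[of "prod_encode (n, j)"] by (simp add: g'_def)
  qed
  have "theta_witness (block_bound f) (\<sigma> ` H)"
    unfolding theta_witness_def
  proof (intro conjI)
    show "\<sigma> ` H \<subseteq> f_sequences (block_bound f)"
      using extensions_bounded by (fastforce simp: f_sequences_def \<sigma>_def)
    show "\<forall>s\<in>\<sigma> ` H. \<forall>\<^sub>\<infinity>n. s n \<noteq> {}"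
      using hits extensions_nonempty[OF f sec] by (auto simp: \<sigma>_def elim: eventually_mono)
    show "\<forall>s\<in>\<sigma> ` H. \<forall>t\<in>\<sigma> ` H. (\<forall>\<^sub>\<infinity>n. s n \<subseteq> t n) \<or> (\<forall>\<^sub>\<infinity>n. t n \<subseteq> s n)"
      using chain ordered by blast
  qed (rule diag)
  then show thesis using that card_of_image by blast
qed

section \<open>The lower bound\<close>

lemma o_diagonalizable_countable:
  assumes "countable F" and F: "\<And>\<sigma>. \<sigma> \<in> F \<Longrightarrow> \<forall>\<^sub>\<infinity>n. \<sigma> n \<noteq> {}"
  shows "o_diagonalizable F"
proof (cases "F = {}")
  case True
  then show ?thesis by (simp add: o_diagonalizable_def)
next
  case False
  define s where "s = from_nat_into F"
  have s: "range s = F"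
    unfolding s_def using False assms(1) by (rule range_from_nat_into)
  have "\<exists>n>m. s i n \<noteq> {}" for i m
    using F[of "s i"] s unfolding MOST_nat by (metis gt_ex less_trans rangeI nat_neq_iff)
  then have "\<exists>d. \<forall>i. s i (d i) \<noteq> {} \<and> d i < d (Suc i)"
    by (intro dependent_nat_choice) blast+
  then obtain d where d: "\<And>i. s i (d i) \<noteq> {}" and "\<And>i. d i < d (Suc i)" by blast
  then have "inj d" by (simp add: strict_mono_Suc_iff strict_mono_imp_inj_on)
  \<comment> \<open>Since \<open>d\<close> is injective, \<open>inv d\<close> recovers which member
    is served at \<open>n\<close>; outside the range of \<open>d\<close> the value is
    arbitrary.\<close>
  define g where "g n = (SOME x. x \<in> s (inv d n) n)" for n
  have "g (d i) \<in> s i (d i)" for i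
    using d[of i] \<open>inj d\<close> by (simp add: g_def some_in_eq)
  then show ?thesis using s by (auto simp: o_diagonalizable_def)
qed

lemma uncountable_imp_aleph1_le:
  assumes "\<not> countable A"
  shows "aleph1 \<le>o |A|"
proof -
  have "\<not> |A| \<le>o natLeq"
    using assms by (metis card_of_nat card_of_ordLeq countable_def ordIso_symmetric ordLeq_ordIso_trans)
  then have "natLeq <o |A|"
    by (simp add: card_of_Well_order natLeq_Well_order not_ordLeq_iff_ordLess)
  then show ?thesis
    by (simp add: cardSuc_least card_of_Card_order natLeq_Card_order)
qed

text \<open>A witnessing family is uncountable because countable ones are diagonalized; the default
  value lies above the continuum, itself uncountable.\<close>

lemma aleph1_le_theta: "aleph1 \<le>o theta f"
proof (cases "\<exists>F. theta_witness f F")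
  case True
  then obtain F where F: "theta_witness f F" "theta f =o |F|"
    using theta_attained(1) by blast
  then have "\<not> countable F"
    using o_diagonalizable_countable[of F] by (auto simp: theta_witness_def)
  then show ?thesis
    using uncountable_imp_aleph1_le F(2) ordIso_symmetric ordLeq_ordIso_trans by blast
next
  case False
  have "natLeq <o continuum"
    by (simp add: ordLess_ctwo_cexp natLeq_Card_order)
  then have "aleph1 \<le>o continuum"
    by (simp add: cardSuc_least Card_order_cexp natLeq_Card_order)
  also have "continuum \<le>o cardSuc continuum"
    by (simp add: cardSuc_ordLeq Card_order_cexp)
  finally show ?thesis using False by (simp add: theta_def)
qed

theorem theorem5p12:
  assumes "cov_star =o aleph1"
  shows "theta_star =o aleph1"
proof -
  obtain f H where f: "\<And>k. f k \<noteq> 0" and H: "cov_witness f H" "cov_star = |H|"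
    using cov_star_attained(1) cov_attained(1) by metis
  then have card: "|H| \<le>o aleph1"
    using assms ordIso_imp_ordLeq by metis
  obtain F where F: "theta_witness (block_bound f) F" "|F| \<le>o |H|"
    using theta_witness_from_cov_witness[OF f H(1) card] by blast
  have "theta_star \<le>o theta (block_bound f)"
    by (rule theta_star_attained(2)) (simp add: block_bound_def)
  also have "theta (block_bound f) \<le>o |F|" by (rule theta_attained(2)[OF F(1)])
  also note F(2)
  also note card
  finally have "theta_star \<le>o aleph1" .
  moreover have "aleph1 \<le>o theta_star"
    using theta_star_attained(1) aleph1_le_theta by metis
  ultimately show ?thesis by (simp add: ordIso_iff_ordLeq)
qed

end
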